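(* Let $X$ be a Polish space and $Y$ a standard Borel space. Then the measurable space $(\mathrm{BM}(X,Y),\mathfrak{B}_{\mathrm{BM}}(X,Y))$ is standard Borel.
   Context: $\mathrm{BM}(X,Y)$ is the set of Baire measurable functions $f:X\to Y$ modulo the equivalence relation $f=^*g$ iff $\{x:f(x)=g(x)\}$ is comeager. For a nonempty open $U\subseteq X$ and Baire measurable $A$, $U\Vdash A$ means $U\setminus A$ is meager. For nonempty open $U\subseteq X$ and Borel $A\subseteq Y$, let $[U;A]=\{f\in\mathrm{BM}(X,Y):U\Vdash f^{-1}(A)\}$. $\mathfrak{B}_{\mathrm{BM}}(X,Y)$ is the $\sigma$-algebra on $\mathrm{BM}(X,Y)$ generated by all such sets $[U;A]$. *)

theory Defs
  imports "HOL-Analysis.Analysis"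
begin

definition polish_topology :: "'a topology \<Rightarrow> bool" where
  "polish_topology X \<longleftrightarrow> separable_space X \<and> completely_metrizable_space X"

text \<open>
  A measurable space is represented by a value of type \<^typ>\<open>'a measure\<close>, of which only
  \<^const>\<open>space\<close> and \<^const>\<open>sets\<close> matter. The empty space is Polish, hence standard Borel.
\<close>

definition standard_borel :: "'a measure \<Rightarrow> bool" where
  "standard_borel M \<longleftrightarrow>
     (\<exists>S. polish_topology S \<and> topspace S = space M \<and>
          sets M = sigma_sets (topspace S) {U. openin S U})"

definition nowhere_dense_in :: "'a topology \<Rightarrow> 'a set \<Rightarrow> bool" where
  "nowhere_dense_in X N \<longleftrightarrow> N \<subseteq> topspace X \<and> X interior_of (X closure_of N) = {}"

definition meager_in :: "'a topology \<Rightarrow> 'a set \<Rightarrow> bool" where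
  "meager_in X A \<longleftrightarrow> (\<exists>\<N>. countable \<N> \<and> (\<forall>N\<in>\<N>. nowhere_dense_in X N) \<and> A = \<Union>\<N>)"

definition comeager_in :: "'a topology \<Rightarrow> 'a set \<Rightarrow> bool" where
  "comeager_in X A \<longleftrightarrow> A \<subseteq> topspace X \<and> meager_in X (topspace X - A)"

definition baire_property_in :: "'a topology \<Rightarrow> 'a set \<Rightarrow> bool" where
  "baire_property_in X A \<longleftrightarrow>
     A \<subseteq> topspace X \<and> (\<exists>U. openin X U \<and> meager_in X ((A - U) \<union> (U - A)))"

text \<open>
  Functions from \<open>X\<close> to \<open>Y\<close> are extensional (\<^const>\<open>undefined\<close> off the carrier), so that each
  set-theoretic function between the carriers is represented exactly once.
\<close>

definition baire_measurable :: "'a topology \<Rightarrow> 'b measure \<Rightarrow> ('a \<Rightarrow> 'b) set" where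
  "baire_measurable X Y =
     {f \<in> topspace X \<rightarrow>\<^sub>E space Y. \<forall>A\<in>sets Y. baire_property_in X (f -` A \<inter> topspace X)}"

definition eq_star :: "'a topology \<Rightarrow> 'b measure \<Rightarrow> (('a \<Rightarrow> 'b) \<times> ('a \<Rightarrow> 'b)) set" where
  "eq_star X Y =
     {(f, g). f \<in> baire_measurable X Y \<and> g \<in> baire_measurable X Y \<and>
              comeager_in X {x \<in> topspace X. f x = g x}}"

definition BM :: "'a topology \<Rightarrow> 'b measure \<Rightarrow> ('a \<Rightarrow> 'b) set set" where
  "BM X Y = baire_measurable X Y // eq_star X Y"

definition forces_in :: "'a topology \<Rightarrow> 'a set \<Rightarrow> 'a set \<Rightarrow> bool" where
  "forces_in X U A \<longleftrightarrow> meager_in X (U - A)"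

definition BM_basic :: "'a topology \<Rightarrow> 'b measure \<Rightarrow> 'a set \<Rightarrow> 'b set \<Rightarrow> ('a \<Rightarrow> 'b) set set" where
  "BM_basic X Y U A =
     {eq_star X Y `` {f} | f. f \<in> baire_measurable X Y \<and> forces_in X U (f -` A \<inter> topspace X)}"

definition BM_space :: "'a topology \<Rightarrow> 'b measure \<Rightarrow> ('a \<Rightarrow> 'b) set measure" where
  "BM_space X Y =
     sigma (BM X Y) {BM_basic X Y U A | U A. openin X U \<and> U \<noteq> {} \<and> A \<in> sets Y}"

lemma BM_basic_subset: "BM_basic X Y U A \<subseteq> BM X Y"
  by (auto simp: BM_basic_def BM_def quotient_def)

lemma space_BM_space: "space (BM_space X Y) = BM X Y"
  unfolding BM_space_def using BM_basic_subset by (intro space_measure_of) blast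

lemma sets_BM_space:
  "sets (BM_space X Y) =
     sigma_sets (BM X Y) {BM_basic X Y U A | U A. openin X U \<and> U \<noteq> {} \<and> A \<in> sets Y}"
  unfolding BM_space_def using BM_basic_subset by (intro sets_measure_of) blast

end

theory Submission
  imports Defs
begin

text \<open>
  Fix a countable base \<open>U n\<close> of nonempty open sets of \<open>X\<close>, a complete metric on \<open>Y\<close> and a dense
  sequence \<open>D j\<close> in \<open>Y\<close>. A class \<open>[f]\<close> is coded by the function \<open>\<nat> \<times> \<nat> \<rightarrow> \<nat>\<close> that sends \<open>(n, k)\<close> to the
  least (number of a) pair \<open>(m, j)\<close> such that \<open>U m \<subseteq> U n\<close> and \<open>U m\<close> forces \<open>f\<close> into the closed ball of
  radius \<open>2\<^sup>-\<^sup>k\<close> about \<open>D j\<close>. Such a pair exists because nonempty open sets are nonmeager, and the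
  balls determine \<open>f\<close> on a comeager set, so the coding is injective. That a smaller pair does not
  work is witnessed by a single value of the code, so the codes form a \<open>G\<^sub>\<delta>\<close> set, which is
  Polish. The \<sigma>-algebra of sets \<open>[U; A]\<close> is the Borel \<sigma>-algebra pulled back along the coding.
\<close>

section \<open>Meager sets and the Baire property\<close>

lemma nowhere_dense_in_subset: "nowhere_dense_in X B \<Longrightarrow> A \<subseteq> B \<Longrightarrow> nowhere_dense_in X A"
  unfolding nowhere_dense_in_def
  using interior_of_mono[OF closure_of_mono] by fastforce

lemma meager_in_subset:
  assumes "meager_in X B" "A \<subseteq> B" shows "meager_in X A"
proof -
  obtain \<N> where "countable \<N>" "\<forall>N\<in>\<N>. nowhere_dense_in X N" "B = \<Union>\<N>"
    using assms(1) by (auto simp: meager_in_def)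
  then show ?thesis using assms(2) unfolding meager_in_def
    by (intro exI[of _ "(\<lambda>N. N \<inter> A) ` \<N>"]) (auto intro: nowhere_dense_in_subset)
qed

lemma meager_in_UN:
  assumes "countable I" "\<And>i. i \<in> I \<Longrightarrow> meager_in X (A i)"
  shows "meager_in X (\<Union>i\<in>I. A i)"
proof -
  obtain \<N> where N: "\<And>i. i \<in> I \<Longrightarrow> countable (\<N> i) \<and> (\<forall>N\<in>\<N> i. nowhere_dense_in X N) \<and> A i = \<Union>(\<N> i)"
    using assms(2) unfolding meager_in_def by metis
  then show ?thesis
    unfolding meager_in_def
    by (intro exI[of _ "\<Union>i\<in>I. \<N> i"]) (use assms(1) in auto)
qed

lemma meager_in_empty [simp]: "meager_in X {}"
  unfolding meager_in_def by (intro exI[of _ "{}"]) auto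

lemma meager_in_Un: "meager_in X A \<Longrightarrow> meager_in X B \<Longrightarrow> meager_in X (A \<union> B)"
  using meager_in_UN[of "{A,B}" X id] by auto

lemma nowhere_dense_in_imp_meager_in: "nowhere_dense_in X A \<Longrightarrow> meager_in X A"
  unfolding meager_in_def by (intro exI[of _ "{A}"]) auto

text \<open>This is the Baire category theorem, applied to the closures of the nowhere dense
  pieces.\<close>

lemma completely_metrizable_not_meager_openin:
  assumes "completely_metrizable_space X" "openin X U" "U \<noteq> {}"
  shows "\<not> meager_in X U"
proof
  assume "meager_in X U"
  then obtain \<N> where N: "countable \<N>" "\<forall>N\<in>\<N>. nowhere_dense_in X N" "U = \<Union>\<N>"
    by (auto simp: meager_in_def)
  have "X interior_of \<Union>((\<lambda>N. X closure_of N) ` \<N>) = {}"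
    using assms(1) N by (intro Baire_category_alt) (auto simp: nowhere_dense_in_def)
  moreover have "U \<subseteq> \<Union>((\<lambda>N. X closure_of N) ` \<N>)"
    using N closure_of_subset by (fastforce simp: nowhere_dense_in_def)
  ultimately show False
    using assms by (metis interior_of_maximal subset_empty)
qed

text \<open>The set is the boundary of \<open>C\<close>: it is closed, and an open subset of it
  would lie in the interior that was removed.\<close>

lemma nowhere_dense_in_closedin_diff_interior:
  assumes "closedin X C" shows "nowhere_dense_in X (C - X interior_of C)"
proof -
  have cl: "closedin X (C - X interior_of C)"
    using assms by (simp add: closedin_diff)
  have "X interior_of (C - X interior_of C) \<subseteq> X interior_of C \<inter> (C - X interior_of C)"
    using interior_of_mono[of "C - X interior_of C" C X] interior_of_subset by fastforce
  then show ?thesis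
    using cl closedin_subset[OF cl] by (auto simp: nowhere_dense_in_def closure_of_closedin)
qed

text \<open>If \<open>A\<close> is approximated by \<open>U\<close>, its complement is approximated
  by the closed set \<open>topspace X - U\<close>, which differs from its own interior only by a
  nowhere dense boundary. That interior is the open set required.\<close>

lemma baire_property_in_compl:
  assumes "baire_property_in X A" shows "baire_property_in X (topspace X - A)"
proof -
  obtain U where U: "openin X U" "meager_in X ((A - U) \<union> (U - A))" and A: "A \<subseteq> topspace X"
    using assms by (auto simp: baire_property_in_def)
  let ?C = "topspace X - U" let ?V = "X interior_of ?C"
  have "meager_in X (((A - U) \<union> (U - A)) \<union> (?C - ?V))"
    using U nowhere_dense_in_closedin_diff_interior[of X ?C]
    by (intro meager_in_Un[OF U(2)] nowhere_dense_in_imp_meager_in) auto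
  then have "meager_in X ((topspace X - A - ?V) \<union> (?V - (topspace X - A)))"
    by (rule meager_in_subset) (use interior_of_subset[of X ?C] in blast)
  then show ?thesis
    unfolding baire_property_in_def by (intro conjI exI[of _ ?V]) auto
qed

lemma baire_property_in_UN:
  assumes "countable I" "\<And>i. i \<in> I \<Longrightarrow> baire_property_in X (A i)"
  shows "baire_property_in X (\<Union>i\<in>I. A i)"
proof -
  obtain V where V: "\<And>i. i \<in> I \<Longrightarrow> openin X (V i) \<and> meager_in X ((A i - V i) \<union> (V i - A i))"
    using assms(2) unfolding baire_property_in_def by metis
  have "meager_in X (\<Union>i\<in>I. (A i - V i) \<union> (V i - A i))"
    using assms(1) V by (intro meager_in_UN) auto
  then have "meager_in X (((\<Union>i\<in>I. A i) - (\<Union>i\<in>I. V i)) \<union> ((\<Union>i\<in>I. V i) - (\<Union>i\<in>I. A i)))"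
    by (rule meager_in_subset) blast
  moreover have "openin X (\<Union>i\<in>I. V i)" "(\<Union>i\<in>I. A i) \<subseteq> topspace X"
    using V assms(2) by (auto simp: baire_property_in_def)
  ultimately show ?thesis
    unfolding baire_property_in_def by (intro conjI exI[of _ "\<Union>i\<in>I. V i"])
qed

text \<open>\<open>A\<close> and \<open>V\<close> can differ only off \<open>G\<close>. This serves
  for a function rebuilt from a code, whose values are controlled only on a comeager set.\<close>

lemma baire_property_in_openin_Int_comeager:
  assumes "openin X V" "comeager_in X G" "A \<subseteq> topspace X" "A \<inter> G = V \<inter> G"
  shows "baire_property_in X A"
proof -
  have sub: "(A - V) \<union> (V - A) \<subseteq> topspace X - G"
  proof
    fix x assume x: "x \<in> (A - V) \<union> (V - A)"
    then have "x \<in> topspace X" using assms(3) openin_subset[OF assms(1)] by auto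
    moreover have "x \<in> A \<inter> G \<longleftrightarrow> x \<in> V \<inter> G" using assms(4) by simp
    ultimately show "x \<in> topspace X - G" using x by auto
  qed
  have "meager_in X ((A - V) \<union> (V - A))"
    by (rule meager_in_subset[OF _ sub]) (use assms(2) in \<open>simp add: comeager_in_def\<close>)
  then show ?thesis
    unfolding baire_property_in_def using assms(1,3) by (intro conjI exI[of _ V])
qed

lemma comeager_in_superset:
  assumes "comeager_in X A" "A \<subseteq> B" "B \<subseteq> topspace X" shows "comeager_in X B"
  using assms unfolding comeager_in_def
  by (intro conjI meager_in_subset[of X "topspace X - A" "topspace X - B"] Diff_mono) simp_all

lemma comeager_in_Int: "comeager_in X A \<Longrightarrow> comeager_in X B \<Longrightarrow> comeager_in X (A \<inter> B)"
  unfolding comeager_in_def Diff_Int by (simp add: le_infI1 meager_in_Un)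

lemma comeager_in_topspace [simp]: "comeager_in X (topspace X)"
  by (simp add: comeager_in_def)

lemma comeager_in_INT:
  assumes "\<And>i::'i::countable. comeager_in X (A i)"
  shows "comeager_in X (\<Inter>i. A i)"
proof -
  have "meager_in X (\<Union>i. topspace X - A i)"
    using assms by (intro meager_in_UN) (auto simp: comeager_in_def)
  then show ?thesis
    using assms by (auto simp: comeager_in_def)
qed

lemma comeager_in_dense_openin:
  assumes "openin X W" "\<And>V. openin X V \<Longrightarrow> V \<noteq> {} \<Longrightarrow> V \<inter> W \<noteq> {}"
  shows "comeager_in X W"
proof -
  have "X interior_of (topspace X - W) = {}"
    using assms(2)[OF openin_interior_of] interior_of_subset[of X "topspace X - W"] by fastforce
  then have "nowhere_dense_in X (topspace X - W)"
    using nowhere_dense_in_closedin_diff_interior[of X "topspace X - W"] assms(1) by auto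
  then show ?thesis
    using assms(1) by (auto simp: comeager_in_def openin_subset nowhere_dense_in_imp_meager_in)
qed

section \<open>Functions modulo meager sets\<close>

lemma equiv_eq_star: "equiv (baire_measurable X Y) (eq_star X Y)"
proof (rule equivI)
  show "eq_star X Y \<subseteq> baire_measurable X Y \<times> baire_measurable X Y"
    by (auto simp: eq_star_def)
  show "refl_on (baire_measurable X Y) (eq_star X Y)"
    by (auto simp: eq_star_def refl_on_def)
  show "sym (eq_star X Y)"
    by (auto simp: eq_star_def sym_def eq_commute)
  show "trans (eq_star X Y)"
  proof (rule transI)
    fix f g h assume fg: "(f, g) \<in> eq_star X Y" and gh: "(g, h) \<in> eq_star X Y"
    have "comeager_in X ({x \<in> topspace X. f x = g x} \<inter> {x \<in> topspace X. g x = h x})"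
      using fg gh by (intro comeager_in_Int) (auto simp: eq_star_def)
    then have "comeager_in X {x \<in> topspace X. f x = h x}"
      by (rule comeager_in_superset) auto
    then show "(f, h) \<in> eq_star X Y"
      using fg gh by (auto simp: eq_star_def)
  qed
qed

text \<open>\<open>BM_basic\<close> asks only for some representative that is forced into
  \<open>A\<close>. Two representatives differ on a meager set, so the choice is immaterial and
  later arguments may work with any fixed function of the class.\<close>

lemma class_in_BM_basic_iff:
  assumes f: "f \<in> baire_measurable X Y"
  shows "eq_star X Y `` {f} \<in> BM_basic X Y U A \<longleftrightarrow> forces_in X U (f -` A \<inter> topspace X)"
proof
  assume "eq_star X Y `` {f} \<in> BM_basic X Y U A"
  then obtain g where g: "g \<in> baire_measurable X Y" "forces_in X U (g -` A \<inter> topspace X)"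
    "eq_star X Y `` {f} = eq_star X Y `` {g}"
    by (auto simp: BM_basic_def)
  then have "comeager_in X {x \<in> topspace X. f x = g x}"
    using eq_equiv_class_iff[OF equiv_eq_star f g(1)] by (auto simp: eq_star_def)
  then have "meager_in X ((topspace X - {x \<in> topspace X. f x = g x}) \<union> (U - (g -` A \<inter> topspace X)))"
    using g(2) by (auto simp: comeager_in_def forces_in_def intro: meager_in_Un)
  then show "forces_in X U (f -` A \<inter> topspace X)"
    unfolding forces_in_def by (rule meager_in_subset) auto
qed (use f in \<open>auto simp: BM_basic_def\<close>)

section \<open>Polish and standard Borel spaces\<close>

text \<open>The discrete topology on at most one point is Polish. This covers the degenerate case of
  an empty \<open>X\<close> or \<open>Y\<close>.\<close>

lemma standard_borel_subsingleton:
  assumes "\<And>x y. x \<in> space M \<Longrightarrow> y \<in> space M \<Longrightarrow> x = y"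
  shows "standard_borel M"
proof -
  have c: "countable (space M)"
  proof (cases "space M = {}")
    case False
    then obtain x where "space M = {x}" using assms by blast
    then show ?thesis by simp
  qed simp
  have "A \<in> sets M" if "A \<subseteq> space M" for A
  proof -
    have "A = {} \<or> A = space M" using that assms by blast
    then show ?thesis by auto
  qed
  then have "sets M = Pow (space M)" using sets.sets_into_space by blast
  moreover have "sigma_sets (space M) (Pow (space M)) = Pow (space M)"
    using sigma_algebra.sigma_sets_eq[OF sigma_algebra_Pow] .
  moreover have "Collect (openin (discrete_topology (space M))) = Pow (space M)"
    by auto
  ultimately show ?thesis
    unfolding standard_borel_def polish_topology_def
    by (intro exI[of _ "discrete_topology (space M)"])
      (simp add: completely_metrizable_space_discrete_topology c
        second_countable_imp_separable_space second_countable_discrete_topology)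
qed

lemma second_countable_euclidean: "second_countable (euclidean :: 'a::second_countable_topology topology)"
proof -
  obtain B :: "'a set set" where B: "countable B" "topological_basis B"
    using ex_countable_basis by blast
  have "\<exists>V\<in>B. x \<in> V \<and> V \<subseteq> W" if "open W" "x \<in> W" for W x
    by (rule topological_basisE[OF B(2) that]) auto
  then show ?thesis
    unfolding second_countable_def
    by (intro exI[of _ B] conjI) (simp_all add: B(1) topological_basis_open[OF B(2)])
qed

lemma completely_metrizable_space_euclidean_nat_fun:
  "completely_metrizable_space (euclidean :: ('i::countable \<Rightarrow> nat) topology)"
proof -
  have "(euclidean :: nat topology) = discrete_topology UNIV"
    by (rule topology_eq[THEN iffD2]) (auto simp: open_discrete)
  then show ?thesis
    unfolding euclidean_product_topology[symmetric]
    by (subst completely_metrizable_space_product_topology)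
      (auto simp: completely_metrizable_space_discrete_topology)
qed

lemma polish_topology_imp_second_countable:
  assumes "polish_topology X" shows "second_countable X"
proof -
  have "metrizable_space X" "separable_space X"
    using assms by (auto simp: polish_topology_def completely_metrizable_imp_metrizable_space)
  then obtain M d where "Metric_space M d" and X: "X = Metric_space.mtopology M d"
    by (auto simp: metrizable_space_def)
  then interpret Metric_space M d by simp
  obtain C where C: "countable C" "C \<subseteq> M" "mtopology closure_of C = M"
    using \<open>separable_space X\<close> by (auto simp: separable_space_def X)
  let ?B = "(\<lambda>(c, k). mball c (inverse (real (Suc k)))) ` (C \<times> UNIV)"
  have "\<exists>V\<in>?B. x \<in> V \<and> V \<subseteq> W" if W: "openin mtopology W" "x \<in> W" for W x
  proof -
    obtain r where r: "r > 0" "mball x r \<subseteq> W" and "x \<in> M"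
      using W by (meson openin_mtopology subsetD)
    \<comment> \<open>The ball will be centred at a nearby \<open>c\<close> instead of
      \<open>x\<close>, so the distance to \<open>x\<close> is at most twice this radius.\<close>
    obtain k where k: "inverse (real (Suc k)) < r / 2"
      using reals_Archimedean[of "r/2"] r by auto
    have "x \<in> mtopology closure_of C" using C \<open>x \<in> M\<close> by simp
    then have "\<forall>r>0. \<exists>c\<in>C. c \<in> mball x r"
      by (simp add: metric_closure_of)
    then obtain c where c: "c \<in> C" "c \<in> mball x (inverse (real (Suc k)))"
      by (meson inverse_Suc)
    have "x \<in> mball c (inverse (real (Suc k)))" using c by (auto simp: commute)
    moreover have "mball c (inverse (real (Suc k))) \<subseteq> mball x r"
    proof
      fix z assume z: "z \<in> mball c (inverse (real (Suc k)))"
      then have "d x z \<le> d x c + d c z" using c triangle by auto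
      then show "z \<in> mball x r" using z c k \<open>x \<in> M\<close> by auto
    qed
    ultimately show ?thesis using c r by blast
  qed
  then show ?thesis
    unfolding second_countable_def X using C(1) by (intro exI[of _ ?B]) auto
qed

section \<open>Forcing and the coding\<close>

lemma forces_in_mono:
  "forces_in X V A \<Longrightarrow> W \<subseteq> V \<Longrightarrow> A \<subseteq> B \<Longrightarrow> forces_in X W B"
  unfolding forces_in_def by (erule meager_in_subset) auto

lemma forces_in_Int:
  "forces_in X V A \<Longrightarrow> forces_in X V B \<Longrightarrow> forces_in X V (A \<inter> B)"
  unfolding forces_in_def by (simp add: Diff_Int meager_in_Un)

text \<open>\<open>V\<close> would force the empty set, that is, be meager, against Baire
  category.\<close>

lemma forces_in_disjointD:
  assumes "completely_metrizable_space X" "openin X V" "V \<noteq> {}"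
    and "forces_in X V A" "forces_in X V B" "A \<inter> B = {}"
  shows False
  using forces_in_Int[OF assms(4,5)] completely_metrizable_not_meager_openin[OF assms(1-3)] assms(6)
  by (simp add: forces_in_def)

lemma forces_in_INT:
  "forces_in X V (\<Inter>i::'i::countable. A i) \<longleftrightarrow> (\<forall>i. forces_in X V (A i))"
proof
  assume "\<forall>i. forces_in X V (A i)"
  then have "meager_in X (\<Union>i. V - A i)"
    unfolding forces_in_def by (intro meager_in_UN) auto
  then show "forces_in X V (\<Inter>i. A i)"
    unfolding forces_in_def by (rule meager_in_subset) auto
qed (blast intro: forces_in_mono[OF _ order_refl])

lemma eq_if_same_members:
  "A \<subseteq> S \<Longrightarrow> B \<subseteq> S \<Longrightarrow> (\<And>x. x \<in> S \<Longrightarrow> x \<in> A \<longleftrightarrow> x \<in> B) \<Longrightarrow> A = B"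
  by (metis subset_antisym subset_iff)

text \<open>The choices that can be made once \<open>X\<close> and \<open>Y\<close> are nonempty.
  Every \<open>U n\<close> is a nonempty open set, hence nonmeager, so it cannot force two disjoint
  sets.\<close>

locale BM_coding = Metric_space M d for M :: "'b set" and d +
  fixes X :: "'a topology" and Y :: "'b measure" and U :: "nat \<Rightarrow> 'a set" and D :: "nat \<Rightarrow> 'b"
  assumes X_complete: "completely_metrizable_space X"
    and openin_U: "openin X (U n)"
    and U_nonempty: "U n \<noteq> {}"
    and U_base: "openin X V \<Longrightarrow> x \<in> V \<Longrightarrow> \<exists>n. x \<in> U n \<and> U n \<subseteq> V"
    and M_complete: mcomplete
    and space_Y: "space Y = M"
    and sets_Y: "sets Y = sigma_sets M {V. openin mtopology V}"
    and D_in_M: "D j \<in> M"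
    and D_dense: "y \<in> M \<Longrightarrow> r > 0 \<Longrightarrow> \<exists>j. d (D j) y < r"
begin

text \<open>A number \<open>p\<close> encodes the pair \<open>(m, j)\<close>.\<close>

abbreviation "nbhd p \<equiv> U (fst (prod_decode p))"

text \<open>Closed balls are used for two reasons: a limit of centres still lies in the ball, and
  the complement of the ball is open, so that failure to force it can be witnessed by another
  ball.\<close>

definition dball :: "nat \<Rightarrow> nat \<Rightarrow> 'b set" where
  "dball k p = mcball (D (snd (prod_decode p))) ((1/2) ^ k)"

text \<open>Taking the least candidate makes the choice canonical, so the code depends on the class
  alone, and measurably so.\<close>

definition code :: "('a \<Rightarrow> 'b) set \<Rightarrow> nat \<times> nat \<Rightarrow> nat" where
  "code c = (\<lambda>(n, k). LEAST p. nbhd p \<subseteq> U n \<and> c \<in> BM_basic X Y (nbhd p) (dball k p))"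

text \<open>
  The last clause expresses minimality: a smaller candidate \<open>q\<close> fails because \<open>f\<close> is forced away from
  its ball somewhere inside \<open>nbhd q\<close>. In this form every clause is an open condition on \<open>a\<close>.
\<close>

definition is_code :: "(nat \<times> nat \<Rightarrow> nat) \<Rightarrow> bool" where
  "is_code a \<longleftrightarrow>
     (\<forall>n k. nbhd (a (n, k)) \<subseteq> U n) \<and>
     (\<forall>n k n' k'. nbhd (a (n, k)) \<inter> nbhd (a (n', k')) \<noteq> {} \<longrightarrow>
        dball k (a (n, k)) \<inter> dball k' (a (n', k')) \<noteq> {}) \<and>
     (\<forall>n k q. q < a (n, k) \<and> nbhd q \<subseteq> U n \<longrightarrow>
        (\<exists>n' k'. U n' \<subseteq> nbhd q \<and> dball k q \<inter> dball k' (a (n', k')) = {}))"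

lemma openin_sets: "openin mtopology V \<Longrightarrow> V \<in> sets Y"
  by (auto simp: sets_Y)

lemma closedin_sets: "closedin mtopology C \<Longrightarrow> C \<in> sets Y"
  using sets.Diff[OF sets.top openin_sets, of "M - C"] space_Y
  by (simp add: closedin_def double_diff)

lemma dball_sets: "dball k p \<in> sets Y"
  unfolding dball_def by (intro closedin_sets closedin_mcball)

lemma baire_measurableD:
  assumes "f \<in> baire_measurable X Y"
  shows "x \<in> topspace X \<Longrightarrow> f x \<in> M"
    and "A \<in> sets Y \<Longrightarrow> baire_property_in X (f -` A \<inter> topspace X)"
  using assms by (auto simp: baire_measurable_def space_Y)

section \<open>Category relative to the base\<close>

lemma U_subset: "U n \<subseteq> topspace X"
  using openin_U openin_subset by blast

text \<open>The union is open, and it is dense because every nonempty open set contains some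
  \<open>U n\<close> and with it \<open>U (s n)\<close>.\<close>

lemma comeager_in_UN_base:
  assumes "\<And>n. U (s n) \<subseteq> U n"
  shows "comeager_in X (\<Union>n. U (s n))"
proof (rule comeager_in_dense_openin)
  fix V assume "openin X V" "V \<noteq> {}"
  then obtain n where n: "U n \<subseteq> V" using U_base by blast
  obtain x where x: "x \<in> U (s n)" using U_nonempty by blast
  then have "x \<in> V" using n assms[of n] by blast
  with x show "V \<inter> (\<Union>n. U (s n)) \<noteq> {}" by blast
qed (auto intro: openin_U)

text \<open>Localization: \<open>A\<close> equals an open \<open>V\<close> up to a meager set. Since
  \<open>A\<close> is nonmeager in \<open>U n\<close>, \<open>V\<close> meets \<open>U n\<close>,
  and any base set inside both forces \<open>A\<close>.\<close>

lemma not_meager_imp_forces: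
  assumes "baire_property_in X A" "\<not> meager_in X (U n \<inter> A)"
  obtains m where "U m \<subseteq> U n" "forces_in X (U m) A"
proof -
  obtain V where V: "openin X V" "meager_in X ((A - V) \<union> (V - A))"
    using assms(1) by (auto simp: baire_property_in_def)
  have "U n \<inter> V \<noteq> {}"
    using assms(2) meager_in_subset[OF V(2), of "U n \<inter> A"] by blast
  then obtain m where "U m \<subseteq> U n \<inter> V"
    using U_base[of "U n \<inter> V"] V(1) openin_U by blast
  moreover have "forces_in X (U m) A"
    unfolding forces_in_def by (rule meager_in_subset[OF V(2)]) (use calculation in blast)
  ultimately show thesis using that by auto
qed

text \<open>The meager sets are closed under countable unions, so one piece is already nonmeager in
  \<open>U n\<close>; localization applies to that piece.\<close>

lemma not_meager_Union_imp_forces: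
  assumes f: "f \<in> baire_measurable X Y" and "countable I" "\<And>i. i \<in> I \<Longrightarrow> A i \<in> sets Y"
    and "\<not> meager_in X (U n \<inter> f -` (\<Union>i\<in>I. A i))"
  obtains i m where "i \<in> I" "U m \<subseteq> U n" "forces_in X (U m) (f -` A i \<inter> topspace X)"
proof -
  have "\<exists>i\<in>I. \<not> meager_in X (U n \<inter> (f -` A i \<inter> topspace X))"
  proof (rule ccontr)
    assume "\<not> ?thesis"
    then have "meager_in X (\<Union>i\<in>I. U n \<inter> (f -` A i \<inter> topspace X))"
      using assms(2) by (intro meager_in_UN) auto
    then have "meager_in X (U n \<inter> f -` (\<Union>i\<in>I. A i))"
      by (rule meager_in_subset) (use U_subset in blast)
    with assms(4) show False by simp
  qed
  then show thesis
    using that not_meager_imp_forces baire_measurableD(2)[OF f assms(3)] by metis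
qed

lemma forces_vimage_disjointD:
  assumes "U l \<subseteq> V" "U l \<subseteq> W" "A \<inter> B = {}"
    and "forces_in X V (f -` A \<inter> topspace X)" "forces_in X W (f -` B \<inter> topspace X)"
  shows False
proof (rule forces_in_disjointD[OF X_complete openin_U U_nonempty])
  show "forces_in X (U l) (f -` A \<inter> topspace X)" "forces_in X (U l) (f -` B \<inter> topspace X)"
    using forces_in_mono[OF assms(4,1) order_refl] forces_in_mono[OF assms(5,2) order_refl] by auto
qed (use assms in auto)

lemma half_power_small: "(r::real) > 0 \<Longrightarrow> \<exists>k. (1/2) ^ k < r"
  by (rule real_arch_pow_inv) auto

text \<open>The balls of radius \<open>(1/2) ^ k\<close> about the dense sequence are countably many
  and cover \<open>Y\<close>, so the preimage of one of them is nonmeager in \<open>U n\<close> and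
  is forced on a smaller base set.\<close>

lemma code_exists:
  assumes f: "f \<in> baire_measurable X Y"
  shows "\<exists>p. nbhd p \<subseteq> U n \<and> forces_in X (nbhd p) (f -` dball k p \<inter> topspace X)"
proof -
  \<comment> \<open>The component 0 is a dummy: \<open>dball\<close> reads only the index of the
    centre.\<close>
  have "f x \<in> (\<Union>j. dball k (prod_encode (0, j)))" if "x \<in> U n" for x
  proof -
    have fx: "f x \<in> M" using baire_measurableD(1)[OF f] U_subset that by blast
    obtain j where "d (D j) (f x) < (1/2) ^ k" using D_dense[OF fx, of "(1/2) ^ k"] by auto
    then have "f x \<in> dball k (prod_encode (0, j))" using fx D_in_M by (simp add: dball_def)
    then show ?thesis by blast
  qed
  then have "U n \<subseteq> U n \<inter> f -` (\<Union>j. dball k (prod_encode (0, j)))" by blast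
  then have "\<not> meager_in X (U n \<inter> f -` (\<Union>j. dball k (prod_encode (0, j))))"
    using completely_metrizable_not_meager_openin[OF X_complete openin_U U_nonempty]
      meager_in_subset[of X _ "U n"] by blast
  then obtain j m where "U m \<subseteq> U n"
    "forces_in X (U m) (f -` dball k (prod_encode (0, j)) \<inter> topspace X)"
    by (rule not_meager_Union_imp_forces[OF f countableI_type dball_sets])
  then show ?thesis
    by (intro exI[of _ "prod_encode (m, j)"]) (auto simp: dball_def)
qed

section \<open>Codes of classes: their properties and injectivity of the coding\<close>

lemma BM_cases:
  assumes "c \<in> BM X Y"
  obtains f where "f \<in> baire_measurable X Y" "c = eq_star X Y `` {f}"
  using assms by (auto simp: BM_def elim: quotientE)

lemma code_spec:
  assumes "c \<in> BM X Y"
  shows "nbhd (code c (n, k)) \<subseteq> U n"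
    and "c \<in> BM_basic X Y (nbhd (code c (n, k))) (dball k (code c (n, k)))"
proof -
  obtain f where f: "f \<in> baire_measurable X Y" "c = eq_star X Y `` {f}"
    using assms by (rule BM_cases)
  have "\<exists>p. nbhd p \<subseteq> U n \<and> c \<in> BM_basic X Y (nbhd p) (dball k p)"
    using code_exists[OF f(1)] f by (simp add: class_in_BM_basic_iff)
  from LeastI_ex[OF this]
  show "nbhd (code c (n, k)) \<subseteq> U n"
    and "c \<in> BM_basic X Y (nbhd (code c (n, k))) (dball k (code c (n, k)))"
    by (simp_all add: code_def)
qed

lemma code_least:
  assumes "q < code c (n, k)" "nbhd q \<subseteq> U n"
  shows "c \<notin> BM_basic X Y (nbhd q) (dball k q)"
  using not_less_Least[OF assms(1)[unfolded code_def case_prod_conv]] assms(2) by simp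

lemma class_in_BM: "f \<in> baire_measurable X Y \<Longrightarrow> eq_star X Y `` {f} \<in> BM X Y"
  by (auto simp: BM_def quotientI)

lemma code_forces:
  assumes "f \<in> baire_measurable X Y" and "c = eq_star X Y `` {f}"
  shows "forces_in X (nbhd (code c (n, k))) (f -` dball k (code c (n, k)) \<inter> topspace X)"
proof -
  have "c \<in> BM X Y" using assms by (simp add: class_in_BM)
  from code_spec(2)[OF this, of n k] show ?thesis
    unfolding assms(2) using class_in_BM_basic_iff[OF assms(1)] by blast
qed

text \<open>The factor 3 leaves room: any ball of radius \<open>(1/2) ^ k\<close> that meets the
  small ball about \<open>D j\<close> still lies in \<open>V\<close>.\<close>

lemma openin_eq_Union_dball:
  assumes "openin mtopology V"
  shows "V = (\<Union>(k, j)\<in>{(k, j). mcball (D j) (3 * (1/2) ^ k) \<subseteq> V}. mcball (D j) ((1/2) ^ k))"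
    (is "V = ?R")
proof
  show "?R \<subseteq> V"
  proof (rule UN_least, clarify)
    fix k j y assume kj: "mcball (D j) (3 * (1/2) ^ k) \<subseteq> V" and y: "y \<in> mcball (D j) ((1/2) ^ k)"
    have "(1/2) ^ k \<le> 3 * (1/2::real) ^ k" by simp
    then have "y \<in> mcball (D j) (3 * (1/2) ^ k)" using y by (auto intro: order_trans)
    with kj show "y \<in> V" by blast
  qed
  show "V \<subseteq> ?R"
  proof
    fix y assume y: "y \<in> V"
    then obtain r where r: "r > 0" "mball y r \<subseteq> V" and "y \<in> M"
      using assms by (meson openin_mtopology subsetD)
    \<comment> \<open>One radius for the distance from \<open>y\<close> to \<open>D j\<close>, three
      for the enlarged ball.\<close>
    obtain k where k: "(1/2) ^ k < r / 4" using half_power_small[of "r/4"] r by auto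
    obtain j where j: "d (D j) y < (1/2) ^ k" using D_dense[OF \<open>y \<in> M\<close>, of "(1/2) ^ k"] by auto
    have "mcball (D j) (3 * (1/2) ^ k) \<subseteq> mball y r"
    proof
      fix z assume z: "z \<in> mcball (D j) (3 * (1/2) ^ k)"
      then have "d y z \<le> d y (D j) + d (D j) z" using \<open>y \<in> M\<close> triangle by auto
      then show "z \<in> mball y r" using z k j \<open>y \<in> M\<close> by (auto simp: commute[of y "D j"])
    qed
    then show "y \<in> ?R" using r j \<open>y \<in> M\<close> D_in_M by (intro UN_I[of "(k, j)"]) auto
  qed
qed

text \<open>The code detects open sets. One small ball from the decomposition of \<open>V\<close> is
  forced on some \<open>U m\<close>. The code ball at \<open>(m, k)\<close> must meet it, and the
  factor 3 then keeps the code ball inside \<open>V\<close>.\<close>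

lemma code_dball_subset:
  assumes f: "f \<in> baire_measurable X Y" and c: "c = eq_star X Y `` {f}"
    and V: "openin mtopology V" and nm: "\<not> meager_in X (U n \<inter> f -` V)"
  shows "\<exists>n' k'. U n' \<subseteq> U n \<and> dball k' (code c (n', k')) \<subseteq> V"
proof -
  let ?I = "{(k, j). mcball (D j) (3 * (1/2) ^ k) \<subseteq> V}"
  have "\<not> meager_in X (U n \<inter> f -` (\<Union>i\<in>?I. case i of (k, j) \<Rightarrow> mcball (D j) ((1/2) ^ k)))"
    using nm unfolding openin_eq_Union_dball[OF V, symmetric] .
  then obtain i m where i: "i \<in> ?I" and m: "U m \<subseteq> U n"
    and "forces_in X (U m) (f -` (case i of (k, j) \<Rightarrow> mcball (D j) ((1/2) ^ k)) \<inter> topspace X)"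
    by (rule not_meager_Union_imp_forces[OF f, rotated 2]) (auto intro!: closedin_sets)
  then obtain k j where kj: "mcball (D j) (3 * (1/2) ^ k) \<subseteq> V"
    and fo: "forces_in X (U m) (f -` mcball (D j) ((1/2) ^ k) \<inter> topspace X)"
    by auto
  \<comment> \<open>The code is consulted below the forcing set \<open>U m\<close> and at the
    precision \<open>k\<close> of the forced ball.\<close>
  let ?p = "code c (m, k)"
  have "nbhd ?p \<subseteq> U m" using code_spec(1) class_in_BM[OF f] c by blast
  then have "mcball (D j) ((1/2) ^ k) \<inter> dball k ?p \<noteq> {}"
    using forces_vimage_disjointD[OF _ order_refl _ fo code_forces[OF f c]] by blast
  then obtain y where y: "y \<in> M" "d (D j) y \<le> (1/2) ^ k" "d (D (snd (prod_decode ?p))) y \<le> (1/2) ^ k"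
    by (auto simp: dball_def)
  have "dball k ?p \<subseteq> mcball (D j) (3 * (1/2) ^ k)"
  proof
    fix z assume z: "z \<in> dball k ?p"
    let ?e = "D (snd (prod_decode ?p))"
    have "z \<in> M" "d ?e z \<le> (1/2) ^ k" using z by (auto simp: dball_def)
    moreover have "d (D j) z \<le> d (D j) y + d y ?e + d ?e z"
      using triangle[of "D j" y z] triangle[of y ?e z] D_in_M y(1) \<open>z \<in> M\<close> by fastforce
    ultimately show "z \<in> mcball (D j) (3 * (1/2) ^ k)"
      using y D_in_M by (auto simp: commute[of y ?e])
  qed
  then show ?thesis using m kj by blast
qed

lemma is_code_code:
  assumes "c \<in> BM X Y" shows "is_code (code c)"
proof -
  obtain f where f: "f \<in> baire_measurable X Y" "c = eq_star X Y `` {f}"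
    using assms by (rule BM_cases)
  \<comment> \<open>A base set inside both neighbourhoods would force \<open>f\<close> into two
    disjoint balls.\<close>
  have 2: "dball k (code c (n, k)) \<inter> dball k' (code c (n', k')) \<noteq> {}"
    if meet: "nbhd (code c (n, k)) \<inter> nbhd (code c (n', k')) \<noteq> {}" for n k n' k'
  proof
    assume disj: "dball k (code c (n, k)) \<inter> dball k' (code c (n', k')) = {}"
    obtain l where "U l \<subseteq> nbhd (code c (n, k)) \<inter> nbhd (code c (n', k'))"
      using meet U_base[OF openin_Int[OF openin_U openin_U]] by blast
    then show False
      using forces_vimage_disjointD[OF _ _ disj code_forces[OF f] code_forces[OF f]] by blast
  qed
  have 3: "\<exists>n' k'. U n' \<subseteq> nbhd q \<and> dball k q \<inter> dball k' (code c (n', k')) = {}"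
    if q: "q < code c (n, k)" "nbhd q \<subseteq> U n" for n k q
  proof -
    \<comment> \<open>By minimality of the code, \<open>nbhd q\<close> does not force
      \<open>f\<close> into its ball. Hence the open complement of the ball has a preimage that is
      nonmeager in \<open>nbhd q\<close>, and the code detects this.\<close>
    have "meager_in X (nbhd q - (f -` dball k q \<inter> topspace X))"
      if "meager_in X (nbhd q \<inter> f -` (M - dball k q))"
      using that by (rule meager_in_subset) (use U_subset baire_measurableD(1)[OF f(1)] in blast)
    then have "\<not> meager_in X (nbhd q \<inter> f -` (M - dball k q))"
      using code_least[OF q] class_in_BM_basic_iff[OF f(1)] f(2) by (auto simp: forces_in_def)
    moreover have "openin mtopology (M - dball k q)"
      by (simp add: dball_def openin_diff)
    ultimately obtain n' k' where "U n' \<subseteq> nbhd q" "dball k' (code c (n', k')) \<subseteq> M - dball k q"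
      using code_dball_subset[OF f] by meson
    then show ?thesis by (intro exI[of _ n'] exI[of _ k']) auto
  qed
  show ?thesis
    unfolding is_code_def using code_spec(1)[OF assms] 2 3 by (intro conjI allI impI) auto
qed

text \<open>Almost every \<open>x\<close> lies, for each \<open>k\<close>, in some coded
  neighbourhood, and avoids all the meager exceptional sets of \<open>f\<close> and
  \<open>g\<close>. At such \<open>x\<close> both values share a ball of radius
  \<open>(1/2) ^ k\<close> for every \<open>k\<close>, so they agree.\<close>

lemma inj_on_code: "inj_on code (BM X Y)"
proof (rule inj_onI)
  fix c c' assume "c \<in> BM X Y" "c' \<in> BM X Y" and eq: "code c = code c'"
  then obtain f g where f: "f \<in> baire_measurable X Y" "c = eq_star X Y `` {f}"
    and g: "g \<in> baire_measurable X Y" "c' = eq_star X Y `` {g}"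
    by (metis BM_cases)
  let ?N = "\<lambda>k n. nbhd (code c (n, k))"
  have "comeager_in X (\<Union>n. ?N k n)" for k
    using code_spec(1)[OF \<open>c \<in> BM X Y\<close>] by (rule comeager_in_UN_base)
  then have "comeager_in X (\<Inter>k. \<Union>n. ?N k n)" by (rule comeager_in_INT)
  moreover have "comeager_in X (topspace X - (?N k n - (h -` dball k (code c (n, k)) \<inter> topspace X)))"
    if "h = f \<or> h = g" for h n k
  proof -
    have "meager_in X (?N k n - (h -` dball k (code c (n, k)) \<inter> topspace X))"
      using that code_forces[OF f] code_forces[OF g] eq by (auto simp: forces_in_def)
    then show ?thesis
      unfolding comeager_in_def by (auto intro!: meager_in_subset[of X "?N k n - (h -` dball k (code c (n, k)) \<inter> topspace X)"])
  qed
  then have "comeager_in X (\<Inter>(n, k). topspace X - (?N k n - (h -` dball k (code c (n, k)) \<inter> topspace X)))"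
    if "h = f \<or> h = g" for h
    using that by (intro comeager_in_INT) auto
  ultimately have "comeager_in X ((\<Inter>k. \<Union>n. ?N k n)
      \<inter> (\<Inter>(n, k). topspace X - (?N k n - (f -` dball k (code c (n, k)) \<inter> topspace X)))
      \<inter> (\<Inter>(n, k). topspace X - (?N k n - (g -` dball k (code c (n, k)) \<inter> topspace X))))"
    (is "comeager_in X ?G")
    by (intro comeager_in_Int) auto
  moreover have "f x = g x" if x: "x \<in> ?G" for x
  proof (rule ccontr)
    assume ne: "f x \<noteq> g x"
    have xX: "x \<in> topspace X" using x by auto
    then have M: "f x \<in> M" "g x \<in> M" using baire_measurableD(1) f(1) g(1) by auto
    then have "d (f x) (g x) > 0" using ne by simp
    then obtain k where k: "(1/2) ^ k < d (f x) (g x) / 2"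
      using half_power_small[of "d (f x) (g x) / 2"] by auto
    obtain n where "x \<in> ?N k n" using x by blast
    then have "f x \<in> dball k (code c (n, k))" "g x \<in> dball k (code c (n, k))"
      using x by auto
    then have "d (f x) (g x) \<le> (1/2) ^ k + (1/2) ^ k"
      using triangle[of "f x" "D (snd (prod_decode (code c (n, k))))" "g x"]
      by (auto simp: dball_def commute[of "f x"])
    then show False using k by simp
  qed
  ultimately have "comeager_in X {x \<in> topspace X. f x = g x}"
    by (elim comeager_in_superset) auto
  then have "(f, g) \<in> eq_star X Y" using f g by (auto simp: eq_star_def)
  then show "c = c'" using equiv_class_eq[OF equiv_eq_star] f g by blast
qed

section \<open>The set of codes\<close>

text \<open>Coded neighbourhoods containing \<open>x\<close> meet, so by the second clause of
  \<open>is_code\<close> their balls meet. The centres, one for each precision, therefore form a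
  Cauchy sequence, and its limit lies in all the balls.\<close>

lemma is_code_limit_point:
  assumes a: "is_code a" and x: "\<And>k. \<exists>n. x \<in> nbhd (a (n, k))"
  shows "\<exists>y\<in>M. \<forall>n k. x \<in> nbhd (a (n, k)) \<longrightarrow> y \<in> dball k (a (n, k))"
proof -
  let ?D = "\<lambda>n k. D (snd (prod_decode (a (n, k))))"
  obtain \<nu> where \<nu>: "\<And>k. x \<in> nbhd (a (\<nu> k, k))" using x by metis
  have close: "d (?D n k) (?D n' k') \<le> (1/2) ^ k + (1/2) ^ k'"
    if "x \<in> nbhd (a (n, k))" "x \<in> nbhd (a (n', k'))" for n k n' k'
  proof -
    have "dball k (a (n, k)) \<inter> dball k' (a (n', k')) \<noteq> {}"
      using a that unfolding is_code_def by blast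
    then obtain z where z: "z \<in> M" "d (?D n k) z \<le> (1/2) ^ k" "d (?D n' k') z \<le> (1/2) ^ k'"
      by (auto simp: dball_def)
    then show ?thesis
      using triangle[of "?D n k" z "?D n' k'"] D_in_M by (auto simp: commute[of z])
  qed
  let ?s = "\<lambda>k. ?D (\<nu> k) k"
  have "MCauchy ?s"
    unfolding MCauchy_def
  proof (intro conjI allI impI)
    fix e :: real assume "e > 0"
    then obtain K where K: "(1/2) ^ K < e / 2" using half_power_small[of "e/2"] by auto
    have "d (?s k) (?s l) < e" if "K \<le> k" "K \<le> l" for k l
    proof -
      have "(1/2::real) ^ k \<le> (1/2) ^ K" "(1/2::real) ^ l \<le> (1/2) ^ K"
        using that by (auto intro: power_decreasing)
      then show ?thesis using close[OF \<nu> \<nu>, of k l] K by linarith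
    qed
    then show "\<exists>N. \<forall>n n'. N \<le> n \<longrightarrow> N \<le> n' \<longrightarrow> d (?s n) (?s n') < e" by blast
  qed (use D_in_M in auto)
  then obtain y where lim: "limitin mtopology ?s y sequentially"
    using M_complete by (auto simp: mcomplete_def)
  then have y: "y \<in> M" by (simp add: limitin_mspace)
  have "d (?D n k) y \<le> (1/2) ^ k" if "x \<in> nbhd (a (n, k))" for n k
  proof (rule field_le_epsilon)
    fix e :: real assume "e > 0"
    then obtain N where N: "\<And>l. l \<ge> N \<Longrightarrow> d (?s l) y < e / 2"
      using lim unfolding limit_metric_sequentially by (metis half_gt_zero)
    obtain K where K: "(1/2) ^ K < e / 2" using half_power_small[of "e/2"] \<open>e > 0\<close> by auto
    \<comment> \<open>The distance from a centre to \<open>y\<close> is estimated through the centre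
      at stage \<open>?l\<close>; the extra terms \<open>(1/2) ^ ?l\<close> and
      \<open>d (?s ?l) y\<close> are each below \<open>e / 2\<close>.\<close>
    let ?l = "max N K"
    have "(1/2::real) ^ ?l \<le> (1/2) ^ K" by (rule power_decreasing) auto
    moreover have "d (?s ?l) y < e / 2" by (rule N) simp
    ultimately show "d (?D n k) y \<le> (1/2) ^ k + e"
      using triangle[OF D_in_M D_in_M y, of "snd (prod_decode (a (n, k)))" "snd (prod_decode (a (\<nu> ?l, ?l)))"]
        close[OF that \<nu>, of ?l] K by linarith
  qed
  then show ?thesis using y D_in_M by (auto simp: dball_def)
qed

lemma dball_subset_mball:
  assumes y: "y \<in> dball k p" and r: "2 * (1/2) ^ k < r"
  shows "dball k p \<subseteq> mball y r"
proof
  fix z assume z: "z \<in> dball k p"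
  let ?e = "D (snd (prod_decode p))"
  have "y \<in> M" "z \<in> M" "d ?e y \<le> (1/2) ^ k" "d ?e z \<le> (1/2) ^ k"
    using y z by (auto simp: dball_def)
  moreover from this have "d y z \<le> d ?e y + d ?e z"
    using triangle[of y ?e z] D_in_M by (simp add: commute[of y ?e])
  ultimately show "z \<in> mball y r" using r by simp
qed

text \<open>On the comeager set \<open>G\<close> of points having coded neighbourhoods at every
  precision, a function is defined by the common points of the balls. Its class has code
  \<open>a\<close>.\<close>

lemma is_code_imp_code:
  assumes a: "is_code a" shows "\<exists>c\<in>BM X Y. code c = a"
proof -
  have nb: "nbhd (a (n, k)) \<subseteq> U n" for n k using a by (simp add: is_code_def)
  define G where "G = (\<Inter>k. \<Union>n. nbhd (a (n, k)))"
  have G: "comeager_in X G"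
    unfolding G_def by (intro comeager_in_INT comeager_in_UN_base nb)
  then have GX: "G \<subseteq> topspace X" by (simp add: comeager_in_def)
  have "\<forall>x\<in>G. \<exists>y\<in>M. \<forall>n k. x \<in> nbhd (a (n, k)) \<longrightarrow> y \<in> dball k (a (n, k))"
  proof
    fix x assume "x \<in> G"
    then have "\<exists>n. x \<in> nbhd (a (n, k))" for k by (auto simp: G_def)
    then show "\<exists>y\<in>M. \<forall>n k. x \<in> nbhd (a (n, k)) \<longrightarrow> y \<in> dball k (a (n, k))"
      by (rule is_code_limit_point[OF a])
  qed
  then obtain g where g: "\<And>x. x \<in> G \<Longrightarrow> g x \<in> M"
    "\<And>x n k. x \<in> G \<Longrightarrow> x \<in> nbhd (a (n, k)) \<Longrightarrow> g x \<in> dball k (a (n, k))"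
    by metis
  \<comment> \<open>\<open>D 0\<close> is an arbitrary point of \<open>Y\<close>; values off
    \<open>G\<close> do not affect the class.\<close>
  define f where "f = (\<lambda>x\<in>topspace X. if x \<in> G then g x else D 0)"
  have fM: "f x \<in> M" if "x \<in> topspace X" for x using that g D_in_M by (simp add: f_def)
  have fG: "f x = g x" if "x \<in> G" for x using that GX by (auto simp: f_def)
  have openBP: "baire_property_in X (f -` V \<inter> topspace X)" if V: "openin mtopology V" for V
  proof (rule baire_property_in_openin_Int_comeager[OF _ G])
    \<comment> \<open>On \<open>G\<close> this open set is the preimage of \<open>V\<close>: if
      \<open>f x\<close> is in \<open>V\<close>, a sufficiently fine ball of the code containing
      \<open>f x\<close> lies in \<open>V\<close>.\<close>
    let ?W = "\<Union>(n, k)\<in>{(n, k). dball k (a (n, k)) \<subseteq> V}. nbhd (a (n, k))"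
    show "openin X ?W" by (auto intro: openin_U)
    show "f -` V \<inter> topspace X \<inter> G = ?W \<inter> G"
    proof (intro equalityI subsetI)
      fix x assume x: "x \<in> f -` V \<inter> topspace X \<inter> G"
      then obtain r where r: "r > 0" "mball (f x) r \<subseteq> V"
        using V unfolding openin_mtopology by blast
      obtain k where k: "(1/2) ^ k < r / 2" using half_power_small[of "r/2"] r by auto
      obtain n where n: "x \<in> nbhd (a (n, k))" using x by (auto simp: G_def)
      then have "f x \<in> dball k (a (n, k))" using x g fG by auto
      then have "dball k (a (n, k)) \<subseteq> mball (f x) r"
        by (rule dball_subset_mball) (use k in simp)
      then show "x \<in> ?W \<inter> G" using r n x by blast
    qed (use fG g GX in auto)
  qed auto
  have "baire_property_in X (f -` A \<inter> topspace X)" if "A \<in> sets Y" for A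
    using that unfolding sets_Y
  proof induction
    case (Compl A)
    have "f -` (M - A) \<inter> topspace X = topspace X - (f -` A \<inter> topspace X)" using fM by auto
    then show ?case using baire_property_in_compl[OF Compl.IH] by simp
  next
    case (Union A)
    have eq: "f -` (\<Union>i. A i) \<inter> topspace X = (\<Union>i. f -` A i \<inter> topspace X)" by auto
    show ?case unfolding eq by (rule baire_property_in_UN[OF countableI_type Union.IH])
  qed (use openBP[of "{}"] openBP in auto)
  then have f: "f \<in> baire_measurable X Y"
    using fM by (auto simp: baire_measurable_def space_Y f_def)
  let ?c = "eq_star X Y `` {f}"
  have forces: "forces_in X (nbhd (a (n, k))) (f -` dball k (a (n, k)) \<inter> topspace X)" for n k
  proof -
    have "meager_in X (topspace X - G)" using G by (simp add: comeager_in_def)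
    then show ?thesis
      unfolding forces_in_def
      by (rule meager_in_subset) (use U_subset fG g in auto)
  qed
  have "code ?c (n, k) = a (n, k)" for n k
    unfolding code_def case_prod_conv
  proof (rule Least_equality)
    show "nbhd (a (n, k)) \<subseteq> U n \<and> ?c \<in> BM_basic X Y (nbhd (a (n, k))) (dball k (a (n, k)))"
      using nb forces by (simp add: class_in_BM_basic_iff[OF f])
    fix q assume q: "nbhd q \<subseteq> U n \<and> ?c \<in> BM_basic X Y (nbhd q) (dball k q)"
    show "a (n, k) \<le> q"
    proof (rule ccontr)
      assume "\<not> a (n, k) \<le> q"
      \<comment> \<open>The minimality clause yields a coded neighbourhood inside
        \<open>nbhd q\<close> that forces \<open>f\<close> into a ball disjoint from
        \<open>dball k q\<close>.\<close>
      then obtain n' k' where n': "U n' \<subseteq> nbhd q" "dball k q \<inter> dball k' (a (n', k')) = {}"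
        using a q unfolding is_code_def not_le by blast
      moreover have "forces_in X (nbhd q) (f -` dball k q \<inter> topspace X)"
        using q by (simp add: class_in_BM_basic_iff[OF f])
      ultimately show False
        using forces_vimage_disjointD[OF _ order_refl _ _ forces] nb[of n' k'] by (meson order_trans)
    qed
  qed
  then have "code ?c = a" by auto
  then show ?thesis using class_in_BM[OF f] by blast
qed

lemma code_image: "code ` BM X Y = {a. is_code a}"
proof (intro equalityI subsetI)
  fix a assume "a \<in> {a. is_code a}"
  then obtain c where "c \<in> BM X Y" "code c = a" using is_code_imp_code by blast
  then show "a \<in> code ` BM X Y" by blast
qed (use is_code_code in blast)

section \<open>The set of codes is Polish\<close>

lemma open_coord: "open {a :: nat \<times> nat \<Rightarrow> nat. P (a i)}"
  using open_vimage[OF open_discrete[of "Collect P"] continuous_on_product_coordinates[of i]]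
  by (simp add: vimage_def)

text \<open>For fixed indices each clause is built from conditions on single coordinates by finite
  intersections and arbitrary unions, hence is open. There are countably many indices.\<close>

lemma gdelta_in_is_code: "gdelta_in euclidean {a. is_code a}"
proof -
  let ?A = "\<lambda>(n, k). {a :: nat \<times> nat \<Rightarrow> nat. nbhd (a (n, k)) \<subseteq> U n}"
  let ?B = "\<lambda>(n, k, n', k'). {a :: nat \<times> nat \<Rightarrow> nat. nbhd (a (n, k)) \<inter> nbhd (a (n', k')) \<noteq> {} \<longrightarrow>
        dball k (a (n, k)) \<inter> dball k' (a (n', k')) \<noteq> {}}"
  let ?C = "\<lambda>(n, k, q). {a :: nat \<times> nat \<Rightarrow> nat. q < a (n, k) \<and> nbhd q \<subseteq> U n \<longrightarrow>
        (\<exists>n' k'. U n' \<subseteq> nbhd q \<and> dball k q \<inter> dball k' (a (n', k')) = {})}"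
  have "open (?A i)" for i
    using open_coord[of "\<lambda>p. nbhd p \<subseteq> U (fst i)" i] by (simp add: case_prod_unfold)
  moreover have "open (?B i)" for i
  proof -
    obtain n k n' k' where i: "i = (n, k, n', k')" by (metis prod_cases4)
    \<comment> \<open>Splitting by the value at \<open>(n, k)\<close> leaves conditions on one
      coordinate each.\<close>
    have "?B i = (\<Union>p. {a. a (n, k) = p} \<inter> {a. nbhd p \<inter> nbhd (a (n', k')) \<noteq> {} \<longrightarrow>
        dball k p \<inter> dball k' (a (n', k')) \<noteq> {}})"
      by (auto simp: i)
    also have "open \<dots>"
      by (intro open_UN ballI open_Int open_coord[of "\<lambda>s. s = _"]
          open_coord[of "\<lambda>s. nbhd _ \<inter> nbhd s \<noteq> {} \<longrightarrow> dball k _ \<inter> dball k' s \<noteq> {}"])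
    finally show ?thesis .
  qed
  moreover have "open (?C i)" for i
  proof -
    obtain n k q where i: "i = (n, k, q)" by (metis prod_cases3)
    have "?C i = {a. \<not> (q < a (n, k) \<and> nbhd q \<subseteq> U n)} \<union>
        (\<Union>n'. \<Union>k'. {a. U n' \<subseteq> nbhd q \<and> dball k q \<inter> dball k' (a (n', k')) = {}})"
      by (auto simp: i)
    also have "open \<dots>"
      by (intro open_UN ballI open_Un open_coord[of "\<lambda>s. \<not> (q < s \<and> nbhd q \<subseteq> U n)"]
          open_coord[of "\<lambda>s. U _ \<subseteq> nbhd q \<and> dball k q \<inter> dball _ s = {}"])
    finally show ?thesis .
  qed
  ultimately have "gdelta_in euclidean (\<Inter>(range ?A \<union> range ?B \<union> range ?C))"
    by (intro gdelta_in_Inter open_imp_gdelta_in) auto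
  also have "\<Inter>(range ?A \<union> range ?B \<union> range ?C) = {a. is_code a}"
    by (simp add: is_code_def Inf_union_distrib set_eq_iff)
  finally show ?thesis .
qed

text \<open>As \<open>code\<close> is injective, this is the topology that makes it a homeomorphism
  onto the set of codes.\<close>

definition code_topology :: "('a \<Rightarrow> 'b) set topology" where
  "code_topology = pullback_topology (BM X Y) code euclidean"

lemma topspace_code_topology: "topspace code_topology = BM X Y"
  by (simp add: code_topology_def topspace_pullback_topology)

lemma polish_code_topology: "polish_topology code_topology"
proof -
  let ?E = "subtopology euclidean {a. is_code a}"
  have "homeomorphic_map code_topology ?E code"
  proof (rule bijective_open_imp_homeomorphic_map)
    have "continuous_map code_topology euclidean (id \<circ> code)"
      unfolding code_topology_def by (rule continuous_map_pullback) auto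
    then show "continuous_map code_topology ?E code"
      using code_image by (auto simp: continuous_map_in_subtopology topspace_code_topology)
    show "open_map code_topology ?E code"
      unfolding open_map_def
    proof (intro allI impI)
      fix W assume "openin code_topology W"
      then obtain V where V: "open V" "W = code -` V \<inter> BM X Y"
        by (auto simp: code_topology_def openin_pullback_topology)
      then have "code ` W = V \<inter> {a. is_code a}"
        unfolding code_image[symmetric] by auto
      then show "openin ?E (code ` W)" using V by (auto simp: openin_subtopology)
    qed
  qed (use code_image inj_on_code in \<open>auto simp: topspace_code_topology\<close>)
  then have h: "code_topology homeomorphic_space ?E"
    by (rule homeomorphic_map_imp_homeomorphic_space)
  have "completely_metrizable_space ?E"
    by (intro completely_metrizable_space_gdelta_in completely_metrizable_space_euclidean_nat_fun
        gdelta_in_is_code)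
  moreover have "separable_space ?E"
    by (intro second_countable_imp_separable_space second_countable_subtopology second_countable_euclidean)
  ultimately show ?thesis
    unfolding polish_topology_def
    using h homeomorphic_completely_metrizable_space homeomorphic_separable_space by blast
qed

section \<open>Comparison of the \<sigma>-algebras\<close>

lemma BM_basic_in_sets: "A \<in> sets Y \<Longrightarrow> BM_basic X Y (U n) A \<in> sets (BM_space X Y)"
  unfolding sets_BM_space
  by (intro sigma_sets.Basic CollectI exI[of _ "U n"] exI[of _ A] conjI refl openin_U U_nonempty)

text \<open>Each coordinate is the least number satisfying predicates that are measurable in
  \<open>c\<close>, since they test membership in basic sets.\<close>

lemma code_measurable: "code \<in> borel_measurable (BM_space X Y)"
proof (rule measurable_coordinatewise_then_product)
  fix i :: "nat \<times> nat"
  obtain n k where i: "i = (n, k)" by fastforce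
  have [measurable]: "Measurable.pred (BM_space X Y) (\<lambda>c. c \<in> BM_basic X Y (nbhd p) (dball k p))" for p
    using BM_basic_in_sets[OF dball_sets] by measurable
  have "(\<lambda>c. code c i) \<in> measurable (BM_space X Y) (count_space UNIV)"
    unfolding code_def i case_prod_conv by measurable
  then show "(\<lambda>c. code c i) \<in> borel_measurable (BM_space X Y)"
    by (simp add: measurable_cong_sets[OF refl sets_borel_eq_count_space])
qed

section \<open>Basic sets are Borel in the transported topology\<close>

abbreviation "code_sets \<equiv> sigma_sets (BM X Y) {W. openin code_topology W}"

lemma sigma_algebra_code_sets: "sigma_algebra (BM X Y) code_sets"
proof (rule sigma_algebra_sigma_sets)
  show "{W. openin code_topology W} \<subseteq> Pow (BM X Y)"
    unfolding topspace_code_topology[symmetric] by (auto dest: openin_subset)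
qed

text \<open>If \<open>U n\<close> fails to force the complement, then \<open>A\<close> has a
  preimage nonmeager in \<open>U n\<close>, which localization turns into a base set forcing
  \<open>A\<close>. The countable union keeps the right-hand side within a \<sigma>-algebra.\<close>

lemma BM_basic_Compl:
  assumes A: "A \<in> sets Y"
  shows "BM_basic X Y (U n) (M - A) = BM X Y - (\<Union>m\<in>{m. U m \<subseteq> U n}. BM_basic X Y (U m) A)"
proof -
  have "eq_star X Y `` {f} \<in> BM_basic X Y (U n) (M - A) \<longleftrightarrow>
      (\<forall>m. U m \<subseteq> U n \<longrightarrow> eq_star X Y `` {f} \<notin> BM_basic X Y (U m) A)"
    if f: "f \<in> baire_measurable X Y" for f
    unfolding class_in_BM_basic_iff[OF f]
  proof
    assume "forces_in X (U n) (f -` (M - A) \<inter> topspace X)"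
    then show "\<forall>m. U m \<subseteq> U n \<longrightarrow> \<not> forces_in X (U m) (f -` A \<inter> topspace X)"
      using forces_vimage_disjointD[of _ _ _ A "M - A"] by blast
  next
    assume *: "\<forall>m. U m \<subseteq> U n \<longrightarrow> \<not> forces_in X (U m) (f -` A \<inter> topspace X)"
    have "meager_in X (U n \<inter> (f -` A \<inter> topspace X))"
      using not_meager_imp_forces[OF baire_measurableD(2)[OF f A]] * by metis
    then show "forces_in X (U n) (f -` (M - A) \<inter> topspace X)"
      unfolding forces_in_def
      by (rule meager_in_subset) (use baire_measurableD(1)[OF f] U_subset in blast)
  qed
  then have "c \<in> BM_basic X Y (U n) (M - A) \<longleftrightarrow> (\<forall>m. U m \<subseteq> U n \<longrightarrow> c \<notin> BM_basic X Y (U m) A)"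
    if "c \<in> BM X Y" for c
    using that by (metis BM_cases)
  then show ?thesis
    by (intro eq_if_same_members[of _ "BM X Y"] BM_basic_subset) auto
qed

text \<open>Forcing commutes with countable intersections because meager sets are closed under
  countable unions. Unions have no such rule: a union may be forced while no single piece
  is.\<close>

lemma BM_basic_INT:
  "BM_basic X Y V (\<Inter>i::'i::countable. A i) = (\<Inter>i. BM_basic X Y V (A i))"
proof -
  have "c \<in> BM_basic X Y V (\<Inter>i. A i) \<longleftrightarrow> (\<forall>i. c \<in> BM_basic X Y V (A i))" if "c \<in> BM X Y" for c
  proof -
    obtain f where f: "f \<in> baire_measurable X Y" "c = eq_star X Y `` {f}"
      by (rule BM_cases[OF \<open>c \<in> BM X Y\<close>])
    have "f -` (\<Inter>i. A i) \<inter> topspace X = (\<Inter>i. f -` A i \<inter> topspace X)" by auto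
    then show ?thesis unfolding f(2) class_in_BM_basic_iff[OF f(1)] by (simp only: forces_in_INT)
  qed
  then show ?thesis
    using BM_basic_subset[of X Y V "A undefined"]
    by (intro eq_if_same_members[of _ "BM X Y"] BM_basic_subset) auto
qed

text \<open>\<open>U n\<close> fails to force a closed set exactly when some code value taken below
  \<open>U n\<close> has its ball inside the open complement \<open>V\<close>. This is an open
  condition on the code.\<close>

lemma BM_basic_closed_code_sets:
  assumes V: "openin mtopology V"
  shows "BM_basic X Y (U n) (M - V) \<in> code_sets"
proof -
  let ?W = "{a. \<exists>n' k'. U n' \<subseteq> U n \<and> dball k' (a (n', k')) \<subseteq> V}"
  have "c \<in> BM_basic X Y (U n) (M - V) \<longleftrightarrow> code c \<notin> ?W" if "c \<in> BM X Y" for c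
  proof -
    obtain f where f: "f \<in> baire_measurable X Y" "c = eq_star X Y `` {f}"
      by (rule BM_cases[OF \<open>c \<in> BM X Y\<close>])
    have "c \<in> BM_basic X Y (U n) (M - V) \<longleftrightarrow> forces_in X (U n) (f -` (M - V) \<inter> topspace X)"
      unfolding f(2) by (rule class_in_BM_basic_iff[OF f(1)])
    also have "\<dots> \<longleftrightarrow> code c \<notin> ?W"
    proof
      assume fo: "forces_in X (U n) (f -` (M - V) \<inter> topspace X)"
      show "code c \<notin> ?W"
      proof
        assume "code c \<in> ?W"
        then obtain n' k' where n': "U n' \<subseteq> U n" "dball k' (code c (n', k')) \<subseteq> V" by blast
        then have "nbhd (code c (n', k')) \<subseteq> U n" using code_spec(1)[OF that, of n' k'] by blast
        then show False
          using forces_vimage_disjointD[OF _ order_refl _ fo code_forces[OF f]] n'(2) by blast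
      qed
    next
      assume "code c \<notin> ?W"
      then have "meager_in X (U n \<inter> f -` V)"
        using code_dball_subset[OF f V, of n] by auto
      then show "forces_in X (U n) (f -` (M - V) \<inter> topspace X)"
        unfolding forces_in_def
        by (rule meager_in_subset) (use baire_measurableD(1)[OF f(1)] U_subset in blast)
    qed
    finally show ?thesis .
  qed
  then have eq: "BM_basic X Y (U n) (M - V) = BM X Y - (code -` ?W \<inter> BM X Y)"
    by (intro eq_if_same_members[of _ "BM X Y"] BM_basic_subset) auto
  have "?W = (\<Union>n'. \<Union>k'. {a. U n' \<subseteq> U n \<and> dball k' (a (n', k')) \<subseteq> V})" by auto
  also have "open \<dots>" by (intro open_UN ballI open_coord)
  finally have "openin code_topology (code -` ?W \<inter> BM X Y)"
    unfolding code_topology_def openin_pullback_topology by (intro exI[of _ ?W]) simp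
  then show ?thesis
    unfolding eq by (intro sigma_sets.Compl sigma_sets.Basic) auto
qed

lemma BM_basic_code_sets:
  assumes "A \<in> sets Y"
  shows "BM_basic X Y (U n) A \<in> code_sets"
proof -
  interpret S: sigma_algebra "BM X Y" code_sets by (rule sigma_algebra_code_sets)
  have compl: "BM_basic X Y (U n) (M - A) \<in> code_sets"
    if "A \<in> sets Y" "\<And>n. BM_basic X Y (U n) A \<in> code_sets" for A n
    unfolding BM_basic_Compl[OF that(1)] using that(2)
    by (intro S.Diff S.top S.countable_UN') auto
  \<comment> \<open>The induction needs all \<open>n\<close> at once, because complements refer to
    every base set below \<open>U n\<close>. Open sets are complements of closed ones, and unions
    are reduced to intersections by De Morgan.\<close>
  have "\<forall>n. BM_basic X Y (U n) A \<in> code_sets"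
    using assms unfolding sets_Y
  proof induction
    case (Basic V)
    then have V: "openin mtopology V" by simp
    then have "M - (M - V) = V" using openin_subset by fastforce
    moreover have "M - V \<in> sets Y"
      using sets.compl_sets[OF openin_sets[OF V]] by (simp add: space_Y)
    ultimately show ?case
      using compl[of "M - V"] BM_basic_closed_code_sets[OF V] by simp
  next
    case Empty
    have "M - M = {}" by simp
    then show ?case using BM_basic_closed_code_sets[of M] by (metis openin_topspace topspace_mtopology)
  next
    case (Compl A)
    then show ?case using compl unfolding sets_Y by blast
  next
    case (Union A)
    have A: "A i \<in> sets Y" for i using Union.hyps by (simp add: sets_Y)
    then have "A i \<subseteq> M" for i using sets.sets_into_space space_Y by blast
    then have eq: "(\<Union>i. A i) = M - (\<Inter>i. M - A i)" by blast
    have cA: "M - A i \<in> sets Y" for i using sets.compl_sets[OF A] by (simp add: space_Y)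
    have "BM_basic X Y (U n) (\<Inter>i. M - A i) \<in> code_sets" for n
      unfolding BM_basic_INT using compl[OF A] Union.IH by (intro S.countable_INT) auto
    moreover have "(\<Inter>i. M - A i) \<in> sets Y" using cA by (intro sets.countable_INT) auto
    ultimately show ?case unfolding eq by (intro allI compl)
  qed
  then show ?thesis ..
qed

lemma openin_code_topology_sets:
  assumes "openin code_topology W" shows "W \<in> sets (BM_space X Y)"
proof -
  obtain V where V: "open V" "W = code -` V \<inter> BM X Y"
    using assms by (auto simp: code_topology_def openin_pullback_topology)
  have "code -` V \<inter> space (BM_space X Y) \<in> sets (BM_space X Y)"
    by (rule measurable_sets[OF code_measurable]) (simp add: V(1))
  then show ?thesis by (simp add: space_BM_space V(2))
qed

text \<open>One inclusion is the measurability of \<open>code\<close>. For the other, a basic set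
  over an arbitrary open \<open>V\<close> is a countable intersection of basic sets over base
  sets.\<close>

lemma standard_borel_BM_space: "standard_borel (BM_space X Y)"
proof -
  have sub1: "code_sets \<subseteq> sets (BM_space X Y)"
    using sets.sigma_sets_subset[of "{W. openin code_topology W}" "BM_space X Y"]
      openin_code_topology_sets
    unfolding space_BM_space by blast
  have sub2: "sets (BM_space X Y) \<subseteq> code_sets"
    unfolding sets_BM_space
  proof (rule sigma_algebra.sigma_sets_subset[OF sigma_algebra_code_sets], rule subsetI)
    fix B assume "B \<in> {BM_basic X Y V A |V A. openin X V \<and> V \<noteq> {} \<and> A \<in> sets Y}"
    then obtain V A where B: "B = BM_basic X Y V A" and V: "openin X V" "V \<noteq> {}" and A: "A \<in> sets Y"
      by blast
    let ?I = "{n. U n \<subseteq> V}"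
    have I: "?I \<noteq> {}" using U_base[OF V(1)] V(2) by blast
    have V_eq: "(\<Union>n\<in>?I. U n) = V" using U_base[OF V(1)] by auto
    \<comment> \<open>\<open>V\<close> is the union of countably many base sets, so what is
      exceptional on \<open>V\<close> is meager once it is meager on each of them.\<close>
    have "c \<in> BM_basic X Y V A \<longleftrightarrow> (\<forall>n\<in>?I. c \<in> BM_basic X Y (U n) A)" if "c \<in> BM X Y" for c
    proof -
      obtain f where f: "f \<in> baire_measurable X Y" "c = eq_star X Y `` {f}"
        by (rule BM_cases[OF \<open>c \<in> BM X Y\<close>])
      have "meager_in X (\<Union>n\<in>?I. U n - (f -` A \<inter> topspace X))"
        if "\<forall>n\<in>?I. forces_in X (U n) (f -` A \<inter> topspace X)"
        using that unfolding forces_in_def by (intro meager_in_UN) auto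
      moreover have "(\<Union>n\<in>?I. U n - (f -` A \<inter> topspace X)) = V - (f -` A \<inter> topspace X)"
        by (subst (2) V_eq[symmetric]) blast
      ultimately show ?thesis
        unfolding f(2) class_in_BM_basic_iff[OF f(1)]
        using forces_in_mono[of X V "f -` A \<inter> topspace X" "U _" "f -` A \<inter> topspace X"]
        by (auto simp: forces_in_def)
    qed
    then have "B = (\<Inter>n\<in>?I. BM_basic X Y (U n) A)"
      unfolding B
    proof (intro eq_if_same_members[of _ "BM X Y"] BM_basic_subset)
      obtain n where "n \<in> ?I" using I by blast
      then show "(\<Inter>n\<in>?I. BM_basic X Y (U n) A) \<subseteq> BM X Y"
        using BM_basic_subset[of X Y "U n" A] by (intro INF_lower2)
    qed simp
    also have "\<dots> \<in> code_sets"
      using I BM_basic_code_sets[OF A] by (intro sigma_algebra.countable_INT'[OF sigma_algebra_code_sets]) auto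
    finally show "B \<in> code_sets" .
  qed
  show ?thesis
    unfolding standard_borel_def space_BM_space
    by (intro exI[of _ code_topology] conjI polish_code_topology)
      (simp_all only: topspace_code_topology subset_antisym[OF sub2 sub1])
qed

end

theorem theorem4p1:
  fixes X :: "'a topology" and Y :: "'b measure"
  assumes "polish_topology X" and "standard_borel Y"
  shows "standard_borel (BM_space X Y)"
\<comment> \<open>With an empty carrier the sequence \<open>U\<close> or \<open>D\<close> cannot be
  chosen, but there is at most one extensional function and so at most one class.\<close>
proof (cases "topspace X = {} \<or> space Y = {}")
  case True
  show ?thesis
  proof (rule standard_borel_subsingleton)
    have "f = g" if "f \<in> baire_measurable X Y" "g \<in> baire_measurable X Y" for f g
    proof (rule PiE_ext[of f "topspace X" "\<lambda>_. space Y" g])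
      show "f \<in> topspace X \<rightarrow>\<^sub>E space Y" "g \<in> topspace X \<rightarrow>\<^sub>E space Y"
        using that by (simp_all add: baire_measurable_def)
      then show "f x = g x" if "x \<in> topspace X" for x using that True by auto
    qed
    then show "c = c'" if "c \<in> space (BM_space X Y)" "c' \<in> space (BM_space X Y)" for c c'
      using that by (auto simp: space_BM_space BM_def elim!: quotientE)
  qed
next
  case False
  obtain \<B> where \<B>: "countable \<B>" "\<And>V. V \<in> \<B> \<Longrightarrow> openin X V"
    "\<And>V x. openin X V \<Longrightarrow> x \<in> V \<Longrightarrow> \<exists>W\<in>\<B>. x \<in> W \<and> W \<subseteq> V"
    using polish_topology_imp_second_countable[OF assms(1)] unfolding second_countable_def by auto
  \<comment> \<open>The empty set is dropped so that every \<open>U n\<close> is nonempty; what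
    remains still suffices as a base at each point.\<close>
  have "\<B> - {{}} \<noteq> {}" using \<B>(3)[of "topspace X"] False by blast
  then obtain U :: "nat \<Rightarrow> 'a set" where U: "range U = \<B> - {{}}"
    using range_from_nat_into[of "\<B> - {{}}"] \<B>(1) by (meson countable_Diff)
  obtain S where S: "polish_topology S" "topspace S = space Y"
    "sets Y = sigma_sets (topspace S) {V. openin S V}"
    using assms(2) by (auto simp: standard_borel_def)
  then obtain M d where Md: "Metric_space M d" "Metric_space.mcomplete M d"
    "S = Metric_space.mtopology M d"
    by (auto simp: polish_topology_def completely_metrizable_space_def)
  interpret Metric_space M d by (rule Md(1))
  obtain C where C: "countable C" "C \<subseteq> M" "mtopology closure_of C = M"
    using S(1) by (auto simp: polish_topology_def separable_space_def Md(3))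
  have "C \<noteq> {}" using C(3) S(2) Md(3) False by auto
  then obtain D :: "nat \<Rightarrow> 'b" where D: "range D = C"
    using range_from_nat_into[OF _ C(1)] by meson
  interpret BM_coding M d X Y U D
  proof
    show "completely_metrizable_space X" using assms(1) by (simp add: polish_topology_def)
    show "openin X (U n)" "U n \<noteq> {}" for n using U \<B>(2) by blast+
    show "\<exists>n. x \<in> U n \<and> U n \<subseteq> V" if V: "openin X V" "x \<in> V" for V x
    proof -
      obtain W where "W \<in> \<B>" "x \<in> W" "W \<subseteq> V" using \<B>(3)[OF V] by blast
      then have "W \<in> range U" using U by blast
      then show ?thesis using \<open>x \<in> W\<close> \<open>W \<subseteq> V\<close> by blast
    qed
    have "topspace S = M" unfolding Md(3) by simp
    then show "space Y = M" "sets Y = sigma_sets M {V. openin mtopology V}"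
      using S(2,3) by (simp_all only: Md(3))
    show "D j \<in> M" for j using D C(2) by blast
    show "\<exists>j. d (D j) y < r" if "y \<in> M" "r > 0" for y r
    proof -
      have "y \<in> mtopology closure_of C" using C that by simp
      then obtain z where "z \<in> C" "z \<in> mball y r"
        using \<open>r > 0\<close> unfolding metric_closure_of by auto
      then show ?thesis using D by (auto simp: commute)
    qed
  qed (rule Md(2))
  show ?thesis by (rule standard_borel_BM_space)
qed

end
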